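(* Let $p>1$, let $f,F$ be real numbers with $0<f^p\le F$, and let $k\in(0,1]$. Then there exists a non-increasing and continuous function $g_k:(0,1]\to[0,+\infty)$ satisfying $\int_0^1 g_k=f$ and $\int_0^1 g_k^p=F$ such that $$\int_0^k\left(\frac1t\int_0^t g_k\right)^p dt=\sup\left\{\int_0^k\left(\frac1t\int_0^t g\right)^p dt:\ g:(0,1]\to[0,+\infty)\text{ non-increasing},\ \int_0^1 g=f,\ \int_0^1 g^p=F\right\}.$$
   Context: All integrals over subintervals of $(0,1]$ are with respect to Lebesgue measure. *)

theory Defs
  imports "HOL-Analysis.Analysis"
begin

definition admissible :: "real \<Rightarrow> real \<Rightarrow> real \<Rightarrow> (real \<Rightarrow> real) set" where
  "admissible p f F = {g.
     (\<forall>t\<in>{0<..1}. 0 \<le> g t) \<and>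
     antimono_on {0<..1} g \<and>
     set_integrable lborel {0<..1} g \<and>
     (LBINT t:{0<..1}. g t) = f \<and>
     set_integrable lborel {0<..1} (\<lambda>t. g t powr p) \<and>
     (LBINT t:{0<..1}. g t powr p) = F}"

text \<open>The outer integral takes values in \<open>[0, \<infinity>]\<close>, so that both the integral and the
  supremum over a class of functions are meaningful without an a priori bound. The inner one is a
  finite real number for every admissible \<open>g\<close> and \<open>t \<in> (0, 1]\<close>.\<close>

definition hardy_integral :: "real \<Rightarrow> real \<Rightarrow> (real \<Rightarrow> real) \<Rightarrow> ennreal" where
  "hardy_integral p k g =
     (\<integral>\<^sup>+t\<in>{0<..k}. ennreal ((1 / t * (LBINT s:{0<..t}. g s)) powr p) \<partial>lborel)"

end

theory Submission imports Defs begin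

text \<open>
  The tangents of \<open>x powr p\<close> give the Hoelder-type inequality
  \<open>(\<integral> h) powr p * (\<integral> w) powr (1 - p) \<le> \<integral> h powr p * w powr (1 - p)\<close> for every weight \<open>w > 0\<close>, which is an
  equality when \<open>h\<close> is a multiple of \<open>w\<close>. For \<open>-1 < a < 0\<close>, applying it on each \<open>(0, t]\<close> with \<open>w s = s powr a\<close>
  and exchanging the order of integration bounds the Hardy integral over \<open>(0, k]\<close> by a multiple of
  \<open>\<integral> h powr p * (1 - w powr (1 - p))\<close> over \<open>(0, 1]\<close>, where now \<open>w t = (min t k / k) powr a\<close> is the same power,
  normalised at \<open>k\<close> and constant on \<open>[k, 1]\<close>. Applying the inequality once more, on \<open>(0, 1]\<close> with this \<open>w\<close>,
  leaves a bound that depends only on \<open>p\<close>, \<open>k\<close>, \<open>a\<close>, \<open>f\<close> and \<open>F\<close>. Every step is an equality for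
  \<open>h = c * w\<close>, and the intermediate value theorem provides \<open>a\<close> and \<open>c\<close> for which \<open>c * w\<close> is admissible.
  If \<open>F = f powr p\<close>, then \<open>a = 0\<close> and the bound degenerates, but every admissible function is constant
  almost everywhere.
\<close>

section \<open>Integrals over sets\<close>

lemma set_integral_nonneg:
  fixes u :: "'a \<Rightarrow> real"
  assumes "\<And>x. x \<in> A \<Longrightarrow> 0 \<le> u x"
  shows "0 \<le> (LINT x:A|M. u x)"
  unfolding set_lebesgue_integral_def using assms
  by (intro Bochner_Integration.integral_nonneg) (simp split: split_indicator)

lemma set_nn_integral_eq_set_integral:
  fixes u :: "'a \<Rightarrow> real"
  assumes "set_integrable M A u" "\<And>x. x \<in> A \<Longrightarrow> 0 \<le> u x"
  shows "(\<integral>\<^sup>+x\<in>A. ennreal (u x) \<partial>M) = ennreal (LINT x:A|M. u x)"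
proof -
  have "(\<integral>\<^sup>+x\<in>A. ennreal (u x) \<partial>M) = (\<integral>\<^sup>+x. ennreal (indicator A x *\<^sub>R u x) \<partial>M)"
    by (intro nn_integral_cong) (simp split: split_indicator)
  also have "\<dots> = ennreal (LINT x:A|M. u x)"
    unfolding set_lebesgue_integral_def using assms
    by (intro nn_integral_eq_integral) (auto simp: set_integrable_def split: split_indicator)
  finally show ?thesis .
qed

lemma set_integrable_mult_bounded:
  fixes u w :: "'a \<Rightarrow> real"
  assumes u: "set_integrable M A u" and [measurable]: "w \<in> borel_measurable M"
    and bound: "\<And>x. x \<in> A \<Longrightarrow> \<bar>w x\<bar> \<le> B"
  shows "set_integrable M A (\<lambda>x. u x * w x)"
proof (rule set_integrable_bound[OF set_integrable_mult_right[OF u, of B]])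
  have [measurable]: "(\<lambda>x. indicator A x * u x) \<in> borel_measurable M"
    using u by (simp add: set_integrable_def)
  show "set_borel_measurable M A (\<lambda>x. u x * w x)"
    by (simp add: set_borel_measurable_def mult.assoc[symmetric])
  have "norm (u x * w x) \<le> norm (B * u x)" if "x \<in> A" for x
    using mult_right_mono[of "\<bar>w x\<bar>" "\<bar>B\<bar>" "\<bar>u x\<bar>"] bound[OF that] by (simp add: abs_mult mult.commute)
  then show "AE x in M. x \<in> A \<longrightarrow> norm (u x * w x) \<le> norm (B * u x)"
    by simp
qed

lemma nonneg_has_integral_imp_set_integral_lborel:
  fixes u :: "'a::euclidean_space \<Rightarrow> real"
  assumes "(u has_integral I) S" and nonneg: "\<And>x. x \<in> S \<Longrightarrow> 0 \<le> u x"
    and "set_borel_measurable lborel S u"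
  shows "set_integrable lborel S u" "(LINT x:S|lborel. u x) = I"
proof -
  have "has_bochner_integral lborel (\<lambda>x. indicator S x *\<^sub>R u x) I"
  proof (rule has_bochner_integral_nn_integral)
    show "0 \<le> I"
      using has_integral_nonneg assms by blast
    show "(\<integral>\<^sup>+x. ennreal (indicator S x *\<^sub>R u x) \<partial>lborel) = ennreal I"
      using nn_integral_has_integral_lebesgue[OF nonneg assms(1)] by simp
  qed (use assms in \<open>auto simp: set_borel_measurable_def split: split_indicator\<close>)
  then show "set_integrable lborel S u" "(LINT x:S|lborel. u x) = I"
    by (auto simp: set_integrable_def set_lebesgue_integral_def has_bochner_integral_iff)
qed

lemma nn_integral_triangle_swap:
  fixes u v :: "real \<Rightarrow> ennreal"
  assumes [measurable]: "u \<in> borel_measurable borel" "v \<in> borel_measurable borel"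
  shows "(\<integral>\<^sup>+t\<in>{a<..b}. u t * (\<integral>\<^sup>+s\<in>{a<..t}. v s \<partial>lborel) \<partial>lborel)
    = (\<integral>\<^sup>+s\<in>{a<..b}. v s * (\<integral>\<^sup>+t\<in>{s..b}. u t \<partial>lborel) \<partial>lborel)"
proof -
  define T where "T = {x \<in> space (lborel \<Otimes>\<^sub>M lborel). a < fst x \<and> fst x \<le> snd x \<and> snd x \<le> b}"
  have [measurable]: "T \<in> sets (lborel \<Otimes>\<^sub>M lborel)"
    unfolding T_def by measurable
  have "(\<integral>\<^sup>+t\<in>{a<..b}. u t * (\<integral>\<^sup>+s\<in>{a<..t}. v s \<partial>lborel) \<partial>lborel)
      = (\<integral>\<^sup>+t. \<integral>\<^sup>+s. u t * v s * indicator T (s, t) \<partial>lborel \<partial>lborel)"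
    by (auto simp flip: nn_integral_cmult nn_integral_multc intro!: nn_integral_cong
        simp: T_def space_pair_measure mult_ac split: split_indicator)
  also have "\<dots> = (\<integral>\<^sup>+s. \<integral>\<^sup>+t. u t * v s * indicator T (s, t) \<partial>lborel \<partial>lborel)"
    by (rule lborel_pair.Fubini') simp
  also have "\<dots> = (\<integral>\<^sup>+s\<in>{a<..b}. v s * (\<integral>\<^sup>+t\<in>{s..b}. u t \<partial>lborel) \<partial>lborel)"
    by (auto simp flip: nn_integral_cmult nn_integral_multc intro!: nn_integral_cong
        simp: T_def space_pair_measure mult_ac split: split_indicator)
  finally show ?thesis .
qed

section \<open>Integrated tangent inequalities for powers\<close>

lemma powr_tangent_less:
  fixes p x y :: real
  assumes "1 < p" "0 \<le> x" "0 \<le> y" "x \<noteq> y"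
  shows "p * x powr (p - 1) * y < y powr p + (p - 1) * x powr p"
proof (cases "x = 0 \<or> y = 0")
  case False
  define u where "u = y / x"
  have u: "0 < u" "y = u * x" "u \<noteq> 1" and "0 < x"
    using assms False by (auto simp: u_def)
  have "ln (1 / u) < 1 / u - 1"
    using u ln_le_minus_one[of "1 / u"] ln_eq_minus_one[of "1 / u"] by fastforce
  then have "1 - 1 / u < ln u"
    using u by (simp add: ln_div)
  then have "1 + (p - 1) * (1 - 1 / u) < 1 + (p - 1) * ln u"
    using assms by simp
  also have "\<dots> \<le> u powr (p - 1)"
    using exp_ge_add_one_self[of "(p - 1) * ln u"] u by (simp add: powr_def)
  finally have "u * (1 + (p - 1) * (1 - 1 / u)) < u * u powr (p - 1)"
    using u by simp
  moreover have "u * (1 + (p - 1) * (1 - 1 / u)) = p * u - (p - 1)"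
    using u by (simp add: field_simps)
  moreover have "u * u powr (p - 1) = u powr p"
    using u by (simp add: powr_diff)
  ultimately have "p * u < u powr p + (p - 1)"
    by simp
  then have "p * u * x powr p < (u powr p + (p - 1)) * x powr p"
    using \<open>0 < x\<close> by simp
  then show ?thesis
    using u \<open>0 < x\<close> by (simp add: powr_mult powr_diff algebra_simps)
qed (use assms in auto)

lemma powr_tangent_le:
  fixes p x y :: real
  assumes "1 < p" "0 \<le> x" "0 \<le> y"
  shows "p * x powr (p - 1) * y \<le> y powr p + (p - 1) * x powr p"
proof (cases "x = y")
  case True
  then show ?thesis
    using assms by (cases "x = 0") (auto simp: powr_diff algebra_simps)
qed (use powr_tangent_less[OF assms] in simp)

lemma powr_perspective_tangent_le:
  fixes p r w y :: real
  assumes "1 < p" "0 \<le> r" "0 < w" "0 \<le> y"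
  shows "p * r powr (p - 1) * y \<le> y powr p * w powr (1 - p) + (p - 1) * r powr p * w"
proof -
  have "w powr (1 - p) * (p * (r * w) powr (p - 1) * y) \<le> w powr (1 - p) * (y powr p + (p - 1) * (r * w) powr p)"
    using assms by (intro mult_left_mono powr_tangent_le) auto
  moreover have "w powr (1 - p) * (r * w) powr (p - 1) = r powr (p - 1)"
    using assms by (simp add: powr_mult powr_diff)
  moreover have "w powr (1 - p) * (r * w) powr p = r powr p * w"
    using assms by (simp add: powr_mult powr_diff)
  ultimately show ?thesis
    by (simp add: algebra_simps)
qed

lemma powr_perspective_set_integral_le:
  fixes h w :: "'a \<Rightarrow> real"
  assumes "1 < p" and nonneg: "\<And>x. x \<in> A \<Longrightarrow> 0 \<le> h x" and pos: "\<And>x. x \<in> A \<Longrightarrow> 0 < w x"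
    and h: "set_integrable M A h" and w: "set_integrable M A w"
    and weighted: "set_integrable M A (\<lambda>x. h x powr p * w x powr (1 - p))"
  shows "(LINT x:A|M. h x) powr p * (LINT x:A|M. w x) powr (1 - p)
    \<le> (LINT x:A|M. h x powr p * w x powr (1 - p))" (is "?H powr p * ?W powr (1 - p) \<le> ?V")
proof -
  \<comment> \<open>The slope at which integrating the tangent inequality loses nothing; if \<open>?W = 0\<close>, the claim is
    trivial because \<open>0 powr (1 - p) = 0\<close>.\<close>
  define r where "r = ?H / ?W"
  have HW: "0 \<le> ?H" "0 \<le> ?W"
    using nonneg pos by (auto intro!: set_integral_nonneg simp: less_imp_le)
  then have "0 \<le> r"
    by (simp add: r_def)
  have "(LINT x:A|M. p * r powr (p - 1) * h x)
      \<le> (LINT x:A|M. h x powr p * w x powr (1 - p) + (p - 1) * r powr p * w x)"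
    using \<open>1 < p\<close> \<open>0 \<le> r\<close> nonneg pos
    by (intro set_integral_mono set_integral_add set_integrable_mult_right impI h w weighted
        powr_perspective_tangent_le)
  then have "p * r powr (p - 1) * ?H \<le> ?V + (p - 1) * r powr p * ?W"
    using set_integral_add(2)[OF weighted set_integrable_mult_right[OF w]] by simp
  moreover have "r powr (p - 1) * ?H = ?H powr p * ?W powr (1 - p)"
    "r powr p * ?W = ?H powr p * ?W powr (1 - p)"
    using HW \<open>1 < p\<close> by (cases "?H = 0"; cases "?W = 0"; simp add: r_def powr_divide powr_diff)+
  ultimately show ?thesis
    by (simp add: algebra_simps)
qed

lemma AE_eq_const_of_powr_set_integral:
  fixes h :: "'a \<Rightarrow> real"
  assumes "1 < p" "0 \<le> c" and A: "A \<in> sets M" "emeasure M A < \<infinity>"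
    and nonneg: "\<And>x. x \<in> A \<Longrightarrow> 0 \<le> h x"
    and h: "set_integrable M A h" "(LINT x:A|M. h x) = measure M A * c"
    and hp: "set_integrable M A (\<lambda>x. h x powr p)" "(LINT x:A|M. h x powr p) = measure M A * c powr p"
  shows "AE x\<in>A in M. h x = c"
proof -
  define gap where "gap x = h x powr p + (p - 1) * c powr p - p * c powr (p - 1) * h x" for x
  have gap_nonneg: "0 \<le> gap x" if "x \<in> A" for x
    using powr_tangent_le[OF \<open>1 < p\<close> \<open>0 \<le> c\<close> nonneg[OF that]] by (simp add: gap_def)
  have integrable_const: "set_integrable M A (\<lambda>_. (p - 1) * c powr p)"
    using A by (simp add: set_integrable_def)
  have gap: "set_integrable M A gap"
    unfolding gap_def
    by (intro set_integral_diff(1)[OF set_integral_add(1)[OF hp(1) integrable_const]]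
        set_integrable_mult_right impI h(1))
  have "(LINT x:A|M. gap x) = (LINT x:A|M. h x powr p) + (LINT x:A|M. (p - 1) * c powr p)
      - p * c powr (p - 1) * (LINT x:A|M. h x)"
    unfolding gap_def using h(1) hp(1) integrable_const
    by (simp add: set_integral_add(1)[OF hp(1) integrable_const])
  also have "(LINT x:A|M. (p - 1) * c powr p) = measure M A * ((p - 1) * c powr p)"
    using A by (simp add: set_integral_const)
  also have "p * c powr (p - 1) * (LINT x:A|M. h x) = p * (measure M A * c powr p)"
    using assms by (cases "c = 0") (auto simp: h(2) powr_diff)
  finally have "(LINT x:A|M. gap x) = 0"
    unfolding hp(2) by (simp add: algebra_simps)
  then have "AE x in M. indicator A x * gap x = 0"
    using gap gap_nonneg integral_nonneg_eq_0_iff_AE[of M "\<lambda>x. indicator A x * gap x"]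
    by (simp add: set_integrable_def set_lebesgue_integral_def indicator_def)
  then show ?thesis
  proof eventually_elim
    case (elim x)
    show ?case
    proof
      assume x: "x \<in> A"
      then have "gap x = 0" using elim by simp
      then show "h x = c"
        using powr_tangent_less[OF \<open>1 < p\<close> \<open>0 \<le> c\<close> nonneg[OF x]] by (fastforce simp: gap_def)
    qed
  qed
qed

section \<open>A weighted Hardy inequality\<close>

lemma set_integral_powr_from_0:
  fixes a t :: real
  assumes "-1 < a" "0 \<le> t"
  shows "set_integrable lborel {0<..t} (\<lambda>s. s powr a)"
    and "(LBINT s:{0<..t}. s powr a) = t powr (a + 1) / (a + 1)"
proof -
  have "((\<lambda>s. s powr a) has_integral t powr (a + 1) / (a + 1)) {0<..t}"
    using has_integral_powr_from_0[OF assms]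
    by (subst has_integral_spike_set_eq[of _ "{0..t}"]) (auto intro: negligible_subset[of "{0}"])
  then show "set_integrable lborel {0<..t} (\<lambda>s. s powr a)"
    "(LBINT s:{0<..t}. s powr a) = t powr (a + 1) / (a + 1)"
    by (intro nonneg_has_integral_imp_set_integral_lborel; simp add: set_borel_measurable_def)+
qed

lemma average_powr_le_weighted:
  fixes h :: "real \<Rightarrow> real"
  assumes "1 < p" "-1 < a" "0 < t" and nonneg: "\<And>s. s \<in> {0<..t} \<Longrightarrow> 0 \<le> h s"
    and h: "set_integrable lborel {0<..t} h"
    and weighted: "set_integrable lborel {0<..t} (\<lambda>s. h s powr p * s powr (a * (1 - p)))"
  shows "(1 / t * (LBINT s:{0<..t}. h s)) powr p
    \<le> (a + 1) powr (1 - p) * t powr (- (a * (1 - p)) - 1)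
      * (LBINT s:{0<..t}. h s powr p * s powr (a * (1 - p)))" (is "(1 / t * ?H) powr p \<le> _ * ?V")
proof -
  define W where "W = t powr (a + 1) / (a + 1)"
  have "0 < W"
    using assms by (simp add: W_def)
  have "0 \<le> ?H"
    using nonneg by (rule set_integral_nonneg)
  have "?H powr p * W powr (1 - p) \<le> ?V"
    using powr_perspective_set_integral_le[of p "{0<..t}" h "\<lambda>s. s powr a" lborel]
      assms set_integral_powr_from_0[of a t] by (simp add: W_def powr_powr)
  then have "W powr (p - 1) * t powr - p * (?H powr p * W powr (1 - p)) \<le> W powr (p - 1) * t powr - p * ?V"
    by (intro mult_left_mono) auto
  moreover have "W powr (p - 1) * t powr - p * (?H powr p * W powr (1 - p)) = (1 / t * ?H) powr p"
    using \<open>0 < W\<close> \<open>0 < t\<close> \<open>0 \<le> ?H\<close> by (simp add: powr_divide powr_minus powr_diff field_simps)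
  moreover have "W powr (p - 1) * t powr - p = (a + 1) powr (1 - p) * t powr (- (a * (1 - p)) - 1)"
  proof -
    have "W powr (p - 1) = t powr ((a + 1) * (p - 1)) * (a + 1) powr (1 - p)"
      using powr_minus_divide[of "a + 1" "p - 1"] by (simp add: W_def powr_divide powr_powr)
    moreover have "(a + 1) * (p - 1) + - p = - (a * (1 - p)) - 1"
      by (simp add: algebra_simps)
    ultimately show ?thesis
      by (metis mult.assoc mult.commute powr_add)
  qed
  ultimately show ?thesis
    by simp
qed

lemma nn_integral_powr_Icc:
  fixes b s k :: real
  assumes "0 < b" "0 < s" "s \<le> k"
  shows "(\<integral>\<^sup>+t\<in>{s..k}. ennreal (t powr (- b - 1)) \<partial>lborel) = ennreal ((s powr - b - k powr - b) / b)"
proof -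
  have "(\<integral>\<^sup>+t\<in>{s..k}. ennreal (t powr (- b - 1)) \<partial>lborel) = ennreal (- (k powr - b) / b - - (s powr - b) / b)"
    by (rule nn_integral_FTC_Icc)
      (use assms in \<open>auto intro!: derivative_eq_intros simp: powr_diff powr_minus field_simps\<close>)
  then show ?thesis
    by (simp add: diff_divide_distrib)
qed

lemma nn_integral_powr_triangle_swap:
  fixes v :: "real \<Rightarrow> ennreal"
  assumes "0 < b" and [measurable]: "v \<in> borel_measurable borel"
  shows "(\<integral>\<^sup>+t\<in>{0<..k}. ennreal (t powr (- b - 1)) * (\<integral>\<^sup>+s\<in>{0<..t}. v s \<partial>lborel) \<partial>lborel)
    = (\<integral>\<^sup>+s\<in>{0<..k}. v s * ennreal ((s powr - b - k powr - b) / b) \<partial>lborel)"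
proof -
  have "(\<integral>\<^sup>+t\<in>{0<..k}. ennreal (t powr (- b - 1)) * (\<integral>\<^sup>+s\<in>{0<..t}. v s \<partial>lborel) \<partial>lborel)
      = (\<integral>\<^sup>+s\<in>{0<..k}. v s * (\<integral>\<^sup>+t\<in>{s..k}. ennreal (t powr (- b - 1)) \<partial>lborel) \<partial>lborel)"
    by (rule nn_integral_triangle_swap) measurable
  also have "\<dots> = (\<integral>\<^sup>+s\<in>{0<..k}. v s * ennreal ((s powr - b - k powr - b) / b) \<partial>lborel)"
    using \<open>0 < b\<close> by (intro set_nn_integral_cong) (auto simp only: nn_integral_powr_Icc greaterThanAtMost_iff)
  finally show ?thesis .
qed

lemma nn_integral_weighted_primitive:
  fixes u :: "real \<Rightarrow> real"
  assumes "0 < b" and nonneg: "\<And>s. s \<in> {0<..k} \<Longrightarrow> 0 \<le> u s" and u: "set_integrable lborel {0<..k} u"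
  shows "(\<integral>\<^sup>+t\<in>{0<..k}. ennreal (t powr (- b - 1) * (LBINT s:{0<..t}. u s * s powr b)) \<partial>lborel)
    = ennreal (LBINT s:{0<..k}. u s * ((1 - (s / k) powr b) / b))"
proof -
  define v where "v s = indicator {0<..k} s * u s * s powr b" for s
  have [measurable]: "(\<lambda>s. indicator {0<..k} s * u s) \<in> borel_measurable borel"
    using u by (simp add: set_integrable_def)
  have [measurable]: "v \<in> borel_measurable borel"
    unfolding v_def by measurable
  have weighted: "set_integrable lborel {0<..k} (\<lambda>s. u s * s powr b)"
    using \<open>0 < b\<close>
    by (intro set_integrable_mult_bounded[OF u, where B = "k powr b"]) (auto intro: powr_mono2)
  have "ennreal (LBINT s:{0<..t}. u s * s powr b) = (\<integral>\<^sup>+s\<in>{0<..t}. ennreal (v s) \<partial>lborel)"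
    if t: "t \<in> {0<..k}" for t
  proof -
    have "ennreal (LBINT s:{0<..t}. u s * s powr b) = (\<integral>\<^sup>+s\<in>{0<..t}. ennreal (u s * s powr b) \<partial>lborel)"
      using t nonneg
      by (intro set_nn_integral_eq_set_integral[symmetric] set_integrable_subset[OF weighted]) auto
    also have "\<dots> = (\<integral>\<^sup>+s\<in>{0<..t}. ennreal (v s) \<partial>lborel)"
      using t by (intro set_nn_integral_cong) (auto simp: v_def)
    finally show ?thesis .
  qed
  then have "(\<integral>\<^sup>+t\<in>{0<..k}. ennreal (t powr (- b - 1) * (LBINT s:{0<..t}. u s * s powr b)) \<partial>lborel)
      = (\<integral>\<^sup>+t\<in>{0<..k}. ennreal (t powr (- b - 1)) * (\<integral>\<^sup>+s\<in>{0<..t}. ennreal (v s) \<partial>lborel) \<partial>lborel)"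
    by (intro set_nn_integral_cong) (auto simp: ennreal_mult')
  also have "\<dots> = (\<integral>\<^sup>+s\<in>{0<..k}. ennreal (v s) * ennreal ((s powr - b - k powr - b) / b) \<partial>lborel)"
    using \<open>0 < b\<close> by (rule nn_integral_powr_triangle_swap) measurable
  also have "\<dots> = (\<integral>\<^sup>+s\<in>{0<..k}. ennreal (u s * ((1 - (s / k) powr b) / b)) \<partial>lborel)"
  proof (intro set_nn_integral_cong refl)
    fix s assume "s \<in> space lborel \<inter> {0<..k}"
    then have s: "0 < s" "s \<le> k" by auto
    have "v s * ((s powr - b - k powr - b) / b) = u s * ((1 - (s / k) powr b) / b)" "0 \<le> v s"
      using s \<open>0 < b\<close> nonneg[of s] by (simp_all add: v_def powr_minus powr_divide field_simps)
    then show "ennreal (v s) * ennreal ((s powr - b - k powr - b) / b) = ennreal (u s * ((1 - (s / k) powr b) / b))"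
      by (simp only: flip: ennreal_mult')
  qed
  also have "\<dots> = ennreal (LBINT s:{0<..k}. u s * ((1 - (s / k) powr b) / b))"
    using \<open>0 < b\<close> nonneg
    by (intro set_nn_integral_eq_set_integral set_integrable_mult_bounded[OF u, where B = "1 / b"])
      (auto simp: powr_le1 divide_right_mono)
  finally show ?thesis .
qed

proposition weighted_hardy_inequality:
  fixes h :: "real \<Rightarrow> real"
  assumes "1 < p" "-1 < a" "a < 0" and nonneg: "\<And>t. t \<in> {0<..k} \<Longrightarrow> 0 \<le> h t"
    and h: "set_integrable lborel {0<..k} h" and hp: "set_integrable lborel {0<..k} (\<lambda>t. h t powr p)"
  shows "hardy_integral p k h
    \<le> ennreal ((a + 1) powr (1 - p) / (a * (1 - p))
        * (LBINT t:{0<..k}. h t powr p * (1 - (t / k) powr (a * (1 - p)))))"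
proof -
  define b where "b = a * (1 - p)"
  define C where "C = (a + 1) powr (1 - p)"
  have "0 < b"
    using assms by (simp add: b_def mult_neg_neg)
  have "(1 / t * (LBINT s:{0<..t}. h s)) powr p
      \<le> t powr (- b - 1) * (LBINT s:{0<..t}. C * h s powr p * s powr b)" if t: "t \<in> {0<..k}" for t
  proof -
    have "set_integrable lborel {0<..t} h"
      using t by (intro set_integrable_subset[OF h]) auto
    moreover have "set_integrable lborel {0<..t} (\<lambda>s. h s powr p * s powr b)"
      using t \<open>0 < b\<close>
      by (intro set_integrable_mult_bounded[where B = "t powr b"] set_integrable_subset[OF hp])
        (auto intro: powr_mono2)
    ultimately have "(1 / t * (LBINT s:{0<..t}. h s)) powr p
        \<le> C * t powr (- b - 1) * (LBINT s:{0<..t}. h s powr p * s powr b)"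
      unfolding C_def b_def using t assms by (intro average_powr_le_weighted) auto
    then show ?thesis
      by (simp add: mult_ac)
  qed
  then have "hardy_integral p k h
      \<le> (\<integral>\<^sup>+t\<in>{0<..k}. ennreal (t powr (- b - 1) * (LBINT s:{0<..t}. C * h s powr p * s powr b)) \<partial>lborel)"
    unfolding hardy_integral_def
    by (intro nn_integral_mono) (auto intro!: ennreal_leI split: split_indicator)
  also have "\<dots> = ennreal (LBINT s:{0<..k}. C * h s powr p * ((1 - (s / k) powr b) / b))"
    using \<open>0 < b\<close> hp by (intro nn_integral_weighted_primitive) (auto simp: C_def)
  also have "(LBINT s:{0<..k}. C * h s powr p * ((1 - (s / k) powr b) / b))
      = C / b * (LBINT s:{0<..k}. h s powr p * (1 - (s / k) powr b))"
    by (simp flip: set_integral_mult_right add: mult_ac)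
  finally show ?thesis
    by (simp add: C_def b_def)
qed

section \<open>Powers that are constant beyond a point\<close>

definition capped_powr :: "real \<Rightarrow> real \<Rightarrow> real \<Rightarrow> real" where
  "capped_powr k a t = (min t k / k) powr a"

definition capped_powr_integral :: "real \<Rightarrow> real \<Rightarrow> real" where
  "capped_powr_integral k a = 1 - k + k / (a + 1)"

lemma capped_powr_powr: "capped_powr k a t powr b = capped_powr k (a * b) t"
  by (simp add: capped_powr_def powr_powr)

lemma capped_powr_nonneg [simp]: "0 \<le> capped_powr k a t"
  by (simp add: capped_powr_def)

lemma capped_powr_pos: "0 < k \<Longrightarrow> 0 < t \<Longrightarrow> 0 < capped_powr k a t"
  by (simp add: capped_powr_def)

lemma capped_powr_measurable [measurable]: "capped_powr k a \<in> borel_measurable borel"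
  unfolding capped_powr_def by measurable

lemma continuous_on_capped_powr:
  assumes "0 < k" shows "continuous_on {0<..} (capped_powr k a)"
  unfolding capped_powr_def using assms by (intro continuous_intros) (auto simp: min_def)

lemma antimono_on_capped_powr:
  assumes "0 < k" "a \<le> 0" shows "antimono_on {0<..} (capped_powr k a)"
  unfolding monotone_on_def capped_powr_def using assms
  by (auto intro!: powr_mono2' divide_right_mono)

lemma capped_powr_integral_pos: "0 < k \<Longrightarrow> k \<le> 1 \<Longrightarrow> -1 < a \<Longrightarrow> 0 < capped_powr_integral k a"
  by (simp add: capped_powr_integral_def add_nonneg_pos)

lemma continuous_on_capped_powr_integral: "continuous_on {-1<..} (capped_powr_integral k)"
  unfolding capped_powr_integral_def by (intro continuous_intros) auto

lemma filterlim_capped_powr_integral_at_right: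
  assumes "0 < k" shows "filterlim (capped_powr_integral k) at_top (at_right (-1))"
  unfolding capped_powr_integral_def
proof (rule filterlim_tendsto_add_at_top[OF tendsto_const] LIM_at_top_divide[OF tendsto_const])+
  show "((\<lambda>a::real. a + 1) \<longlongrightarrow> 0) (at_right (-1))"
    by (auto intro!: tendsto_eq_intros)
qed (use assms in \<open>auto simp: eventually_at_filter\<close>)

lemma set_integral_capped_powr:
  assumes "-1 < a" "0 < k" "k \<le> 1"
  shows "set_integrable lborel {0<..1} (capped_powr k a)"
    and "(LBINT t:{0<..1}. capped_powr k a t) = capped_powr_integral k a"
proof -
  have "((\<lambda>t. t powr a / k powr a) has_integral k powr (a + 1) / (a + 1) / k powr a) {0..k}"
    using assms by (intro has_integral_divide has_integral_powr_from_0) auto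
  then have "(capped_powr k a has_integral k powr (a + 1) / (a + 1) / k powr a) {0..k}"
    by (rule has_integral_eq[rotated]) (use assms in \<open>auto simp: capped_powr_def powr_divide\<close>)
  moreover have "k powr (a + 1) / (a + 1) / k powr a = k / (a + 1)"
    using assms by (simp add: powr_add)
  moreover have "((\<lambda>t. 1) has_integral (1 - k)) {k..1}"
    using has_integral_const_real[of "1::real" k 1] assms by simp
  then have "(capped_powr k a has_integral (1 - k)) {k..1}"
    by (rule has_integral_eq[rotated]) (use assms in \<open>auto simp: capped_powr_def\<close>)
  ultimately have "(capped_powr k a has_integral capped_powr_integral k a) {0..1}"
    using assms has_integral_combine[of 0 k 1 "capped_powr k a" "k / (a + 1)" "1 - k"]
    by (simp add: capped_powr_integral_def add.commute)
  then have "(capped_powr k a has_integral capped_powr_integral k a) {0<..1}"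
    by (subst has_integral_spike_set_eq[of _ "{0..1}"]) (auto intro: negligible_subset[of "{0}"])
  then show "set_integrable lborel {0<..1} (capped_powr k a)"
    "(LBINT t:{0<..1}. capped_powr k a t) = capped_powr_integral k a"
    by (intro nonneg_has_integral_imp_set_integral_lborel;
        simp add: set_borel_measurable_def capped_powr_nonneg)+
qed

section \<open>The extremal problem\<close>

proposition hardy_integral_le_moments:
  assumes "1 < p" "-1 < a" "a < 0" "0 < k" "k \<le> 1" and h: "h \<in> admissible p f F"
  shows "hardy_integral p k h
    \<le> ennreal ((a + 1) powr (1 - p) / (a * (1 - p)) * (F - f powr p * capped_powr_integral k a powr (1 - p)))"
proof -
  define b where "b = a * (1 - p)"
  define I where "I = (LBINT t:{0<..1}. h t powr p * capped_powr k b t)"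
  have "0 < b"
    using assms by (simp add: b_def mult_neg_neg)
  have nonneg: "0 \<le> h t" if "t \<in> {0<..1}" for t
    using h that by (simp add: admissible_def)
  have integrable: "set_integrable lborel {0<..1} h" "set_integrable lborel {0<..1} (\<lambda>t. h t powr p)"
    and integral: "(LBINT t:{0<..1}. h t) = f" "(LBINT t:{0<..1}. h t powr p) = F"
    using h by (auto simp: admissible_def)
  have weighted: "set_integrable lborel {0<..1} (\<lambda>t. h t powr p * capped_powr k b t)"
    using \<open>0 < b\<close> \<open>0 < k\<close>
    by (intro set_integrable_mult_bounded[OF integrable(2), where B = 1])
      (auto simp: capped_powr_def intro!: powr_le1)
  have "f powr p * capped_powr_integral k a powr (1 - p) \<le> I"
    using powr_perspective_set_integral_le[of p "{0<..1}" h "capped_powr k a" lborel]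
      set_integral_capped_powr[of a k] assms nonneg integrable weighted
    by (simp add: integral I_def b_def capped_powr_powr capped_powr_pos)
  moreover have "(LBINT t:{0<..k}. h t powr p * (1 - (t / k) powr b)) = F - I"
  proof -
    have "(LBINT t:{0<..k}. h t powr p * (1 - (t / k) powr b))
        = (LBINT t:{0<..1}. h t powr p - h t powr p * capped_powr k b t)"
      unfolding set_lebesgue_integral_def using \<open>0 < k\<close> \<open>k \<le> 1\<close>
      by (intro Bochner_Integration.integral_cong)
        (auto simp: capped_powr_def algebra_simps split: split_indicator)
    then show ?thesis
      using integrable weighted by (simp add: integral I_def)
  qed
  moreover have "set_integrable lborel {0<..k} h" "set_integrable lborel {0<..k} (\<lambda>t. h t powr p)"
    using \<open>k \<le> 1\<close> by (auto intro: integrable[THEN set_integrable_subset])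
  then have "hardy_integral p k h
      \<le> ennreal ((a + 1) powr (1 - p) / b * (LBINT t:{0<..k}. h t powr p * (1 - (t / k) powr b)))"
    unfolding b_def using assms nonneg by (intro weighted_hardy_inequality) auto
  ultimately show ?thesis
    unfolding b_def[symmetric] using \<open>0 < b\<close>
    by (elim order_trans) (auto intro!: ennreal_leI divide_right_mono mult_left_mono)
qed

lemma capped_powr_admissible:
  assumes "0 < k" "k \<le> 1" "0 \<le> c" "-1 < a" "a \<le> 0" "-1 < a * p"
  shows "(\<lambda>t. c * capped_powr k a t)
    \<in> admissible p (c * capped_powr_integral k a) (c powr p * capped_powr_integral k (a * p))"
proof -
  have "antimono_on {0<..1} (\<lambda>t. c * capped_powr k a t)"
    using antimono_on_capped_powr[of k a] assms
    by (auto simp: monotone_on_def intro!: mult_left_mono)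
  then show ?thesis
    using assms set_integral_capped_powr[of a k] set_integral_capped_powr[of "a * p" k]
    by (simp add: admissible_def powr_mult capped_powr_powr)
qed

lemma hardy_integral_capped_powr:
  assumes "0 < k" "0 \<le> c" "-1 < a" "-1 < a * p"
  shows "hardy_integral p k (\<lambda>t. c * capped_powr k a t) = ennreal ((c / (a + 1)) powr p * (k / (a * p + 1)))"
proof -
  define C where "C = c / (a + 1) / k powr a"
  have "0 \<le> C"
    using assms by (simp add: C_def)
  have "(1 / t * (LBINT s:{0<..t}. c * capped_powr k a s)) powr p = C powr p * t powr (a * p)"
    if t: "t \<in> {0<..k}" for t
  proof -
    have "(LBINT s:{0<..t}. c * capped_powr k a s) = (LBINT s:{0<..t}. c / k powr a * s powr a)"
      using t by (intro set_lebesgue_integral_cong) (auto simp: capped_powr_def powr_divide)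
    also have "\<dots> = C * t powr (a + 1)"
      using t assms by (simp add: C_def set_integral_powr_from_0(2))
    finally have "1 / t * (LBINT s:{0<..t}. c * capped_powr k a s) = C * t powr a"
      using t by (simp add: powr_add)
    then show ?thesis
      using \<open>0 \<le> C\<close> by (simp only: powr_mult powr_powr powr_ge_zero)
  qed
  then have "hardy_integral p k (\<lambda>t. c * capped_powr k a t)
      = (\<integral>\<^sup>+t\<in>{0<..k}. ennreal (C powr p * t powr (a * p)) \<partial>lborel)"
    unfolding hardy_integral_def by (intro set_nn_integral_cong) auto
  also have "\<dots> = ennreal (C powr p * (k powr (a * p + 1) / (a * p + 1)))"
    using assms set_integral_powr_from_0[of "a * p" k]
    by (subst set_nn_integral_eq_set_integral) auto
  also have "C powr p * (k powr (a * p + 1) / (a * p + 1)) = (c / (a + 1)) powr p * (k / (a * p + 1))"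
    using assms by (simp add: C_def powr_divide powr_mult powr_powr powr_add)
  finally show ?thesis .
qed

lemma hardy_integral_cong_AE:
  assumes "k \<le> l" "set_integrable lborel {0<..l} g" "set_integrable lborel {0<..l} h"
    and "AE t\<in>{0<..l} in lborel. g t = h t"
  shows "hardy_integral p k g = hardy_integral p k h"
proof -
  have "(LBINT s:{0<..t}. g s) = (LBINT s:{0<..t}. h s)" if t: "t \<in> {0<..k}" for t
    unfolding set_lebesgue_integral_def
  proof (rule integral_cong_AE)
    show "AE s in lborel. indicator {0<..t} s *\<^sub>R g s = indicator {0<..t} s *\<^sub>R h s"
      using assms(4) by eventually_elim (use t \<open>k \<le> l\<close> in \<open>auto split: split_indicator\<close>)
    have "set_integrable lborel {0<..t} g" "set_integrable lborel {0<..t} h"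
      using t \<open>k \<le> l\<close> by (auto intro: assms(2,3)[THEN set_integrable_subset])
    then show "(\<lambda>s. indicator {0<..t} s *\<^sub>R g s) \<in> borel_measurable lborel"
      "(\<lambda>s. indicator {0<..t} s *\<^sub>R h s) \<in> borel_measurable lborel"
      by (auto simp: set_integrable_def)
  qed
  then show ?thesis
    unfolding hardy_integral_def by (intro set_nn_integral_cong) auto
qed

lemma hardy_integral_eq_of_powr_integral_eq:
  assumes "1 < p" "0 \<le> f" "k \<le> 1"
    and g: "g \<in> admissible p f (f powr p)" and h: "h \<in> admissible p f (f powr p)"
  shows "hardy_integral p k g = hardy_integral p k h"
proof -
  have const: "AE t\<in>{0<..1} in lborel. u t = f" if "u \<in> admissible p f (f powr p)" for u
    using that \<open>1 < p\<close> \<open>0 \<le> f\<close>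
    by (intro AE_eq_const_of_powr_set_integral[where p = p]) (auto simp: admissible_def)
  have "AE t\<in>{0<..1} in lborel. g t = h t"
    using const[OF g] const[OF h] by eventually_elim simp
  then show ?thesis
    using g h \<open>k \<le> 1\<close> by (intro hardy_integral_cong_AE) (auto simp: admissible_def)
qed

lemma hardy_bound_capped_powr_moments:
  fixes p k c a :: real
  assumes "1 < p" "0 < k" "k \<le> 1" "0 < c" "-1 < a" "a < 0" "-1 < a * p"
  defines "W \<equiv> capped_powr_integral k a" and "V \<equiv> capped_powr_integral k (a * p)"
  shows "(a + 1) powr (1 - p) / (a * (1 - p)) * (c powr p * V - (c * W) powr p * W powr (1 - p))
    = (c / (a + 1)) powr p * (k / (a * p + 1))"
proof -
  have "0 < W"
    using assms by (simp add: capped_powr_integral_pos)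
  then have "(c * W) powr p * W powr (1 - p) = c powr p * W"
    using \<open>0 < c\<close> by (simp add: powr_mult powr_diff)
  moreover have "V - W = a * (1 - p) * (k / ((a + 1) * (a * p + 1)))"
    using assms by (simp add: V_def W_def capped_powr_integral_def field_simps)
  ultimately have "c powr p * V - (c * W) powr p * W powr (1 - p)
      = a * (1 - p) * (c powr p * (k / ((a + 1) * (a * p + 1))))"
    by (simp add: algebra_simps)
  then show ?thesis
    using assms by (simp add: powr_diff powr_divide)
qed

proposition hardy_integral_le_capped_powr:
  assumes "1 < p" "0 < k" "k \<le> 1" "0 < c" "-1 < a" "a \<le> 0" "-1 < a * p"
    and h: "h \<in> admissible p (c * capped_powr_integral k a) (c powr p * capped_powr_integral k (a * p))"
  shows "hardy_integral p k h \<le> hardy_integral p k (\<lambda>t. c * capped_powr k a t)"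
proof (cases "a = 0")
  case True
  then have "capped_powr_integral k a = 1" "capped_powr_integral k (a * p) = 1"
    by (simp_all add: capped_powr_integral_def)
  then show ?thesis
    using hardy_integral_eq_of_powr_integral_eq[of p c k h "\<lambda>t. c * capped_powr k a t"]
      capped_powr_admissible[of k c a p] assms by simp
next
  case False
  then show ?thesis
    using hardy_integral_le_moments[OF _ _ _ _ _ h, of a k] hardy_integral_capped_powr[of k c a p]
      hardy_bound_capped_powr_moments[of p k c a] assms by simp
qed

text \<open>The integral of the \<open>p\<close>-th power of the multiple of \<open>capped_powr k a\<close> that has integral \<open>f\<close>.\<close>

definition capped_powr_moment :: "real \<Rightarrow> real \<Rightarrow> real \<Rightarrow> real \<Rightarrow> real" where
  "capped_powr_moment p f k a = (f / capped_powr_integral k a) powr p * capped_powr_integral k (a * p)"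

lemma filterlim_capped_powr_moment_at_right:
  assumes "1 < p" "0 < f" "0 < k" "k \<le> 1"
  shows "filterlim (capped_powr_moment p f k) at_top (at_right (- 1 / p))"
  unfolding capped_powr_moment_def
proof (rule filterlim_tendsto_pos_mult_at_top)
  let ?W = "capped_powr_integral k"
  have "0 < ?W (- 1 / p)"
    using assms by (intro capped_powr_integral_pos) auto
  then show "0 < (f / ?W (- 1 / p)) powr p"
    using assms by simp
  show "((\<lambda>a. (f / ?W a) powr p) \<longlongrightarrow> (f / ?W (- 1 / p)) powr p) (at_right (- 1 / p))"
    unfolding capped_powr_integral_def using assms \<open>0 < ?W (- 1 / p)\<close>
    by (intro tendsto_intros) (auto simp: capped_powr_integral_def)
  have "filterlim (\<lambda>a. a * p) (at_right (-1)) (at_right (- 1 / p))"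
    using \<open>1 < p\<close>
    by (intro tendsto_imp_filterlim_at_right)
      (auto intro!: tendsto_eq_intros simp: eventually_at_filter field_simps)
  then show "filterlim (\<lambda>a. ?W (a * p)) at_top (at_right (- 1 / p))"
    using filterlim_capped_powr_integral_at_right[OF \<open>0 < k\<close>] by (rule filterlim_compose[rotated])
qed

lemma exists_capped_powr_with_moments:
  fixes p f F k :: real
  assumes "1 < p" "0 < f" "f powr p \<le> F" "0 < k" "k \<le> 1"
  obtains a c where "-1 < a" "a \<le> 0" "-1 < a * p" "0 < c"
    "c * capped_powr_integral k a = f" "c powr p * capped_powr_integral k (a * p) = F"
proof -
  let ?W = "capped_powr_integral k" and ?G = "capped_powr_moment p f k"
  have W_pos: "0 < ?W a" if "-1 < a" for a
    using that assms by (intro capped_powr_integral_pos)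
  have exponent: "-1 < a" "-1 < a * p" if "- 1 / p < a" for a
  proof -
    have "-1 < - 1 / p"
      using \<open>1 < p\<close> by simp
    then show "-1 < a"
      using that by linarith
    show "-1 < a * p"
      using that \<open>1 < p\<close> by (simp add: field_simps)
  qed
  have "\<forall>\<^sub>F a in at_right (- 1 / p). F \<le> ?G a"
    using filterlim_capped_powr_moment_at_right[of p f k] assms by (simp add: filterlim_at_top)
  moreover have "\<forall>\<^sub>F a in at_right (- 1 / p). a \<in> {- 1 / p<..<0}"
    using \<open>1 < p\<close> by (intro eventually_at_right_real) simp
  ultimately obtain e where e: "F \<le> ?G e" "- 1 / p < e" "e < 0"
    using eventually_happens'[OF trivial_limit_at_right_real eventually_conj] by fastforce
  have "-1 < a" "-1 < a * p" if "a \<in> {e..0}" for a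
    using that e(2) by (auto intro: exponent)
  then have "continuous_on {e..0} ?G"
    unfolding capped_powr_moment_def using assms W_pos
    by (intro continuous_intros continuous_on_compose2[OF continuous_on_capped_powr_integral]) force+
  moreover have "?G 0 \<le> F"
    using assms by (simp add: capped_powr_moment_def capped_powr_integral_def)
  ultimately obtain a where a: "e \<le> a" "a \<le> 0" "?G a = F"
    using IVT2'[of ?G 0 F e] e by auto
  then show thesis
    using e assms exponent[of a] W_pos[of a]
    by (intro that[of a "f / ?W a"]) (auto simp: capped_powr_moment_def)
qed

theorem theorem1p2:
  fixes p f F k :: real
  assumes "p > 1" and "0 < f" and "f powr p \<le> F" and "0 < k" and "k \<le> 1"
  shows "\<exists>g. g \<in> admissible p f F \<and> continuous_on {0<..1} g \<and>
           hardy_integral p k g = Sup {hardy_integral p k h | h. h \<in> admissible p f F}"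
proof -
  obtain a c where a: "-1 < a" "a \<le> 0" "-1 < a * p" and c: "0 < c"
    and f: "c * capped_powr_integral k a = f" and F: "c powr p * capped_powr_integral k (a * p) = F"
    using exists_capped_powr_with_moments assms by metis
  define g where "g = (\<lambda>t. c * capped_powr k a t)"
  have g: "g \<in> admissible p f F"
    using capped_powr_admissible[of k c a p] a c assms by (simp add: g_def f F)
  have "hardy_integral p k h \<le> hardy_integral p k g" if "h \<in> admissible p f F" for h
    using hardy_integral_le_capped_powr[of p k c a h] a c assms that by (simp add: g_def f F)
  then have "hardy_integral p k g = Sup {hardy_integral p k h | h. h \<in> admissible p f F}"
    using g by (intro antisym Sup_upper Sup_least) auto
  moreover have "continuous_on {0<..1} g"
    unfolding g_def using \<open>0 < k\<close>
    by (intro continuous_intros continuous_on_subset[OF continuous_on_capped_powr]) auto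
  ultimately show ?thesis
    using g by blast
qed

end
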